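(* There is a constant $C>0$ such that the elements of $\hat G_f(t,k)$ have the following upper bounds (entrywise) for $t\ge0$. For $|k|\le\frac{\sqrt{3\gamma}}{2\gamma}$, $$|\hat G_f(t,k)|\le C\begin{pmatrix}1&1\\1&1\end{pmatrix}e^{-\frac t2},$$ and for $|k|>\frac{\sqrt{3\gamma}}{2\gamma}$, $$|\hat G_f(t,k)|\le C\begin{pmatrix}1&|k|\\|k|^{-1}&1\end{pmatrix}e^{-\frac t2}.$$
   Context: $\gamma>0$ is a constant, $k\in\mathbb{R}$. $\hat G_f(t,k)=e^{-t\hat A_1}$ is the Fourier-space Green's function (fundamental matrix) of $\partial_t(\hat u_1,\hat E_1)^T=-\hat A_1(\hat u_1,\hat E_1)^T$ with $\hat A_1=\begin{pmatrix}1&1+\gamma k^2\\-1&0\end{pmatrix}$; explicitly, with $\lambda_\pm=\frac{-1\pm i\sqrt{3+4\gamma k^2}}2$, $$\hat G_f=\frac1{\lambda_+-\lambda_-}\begin{pmatrix}\lambda_+e^{\lambda_+t}-\lambda_-e^{\lambda_-t}&-(1+\gamma k^2)(e^{\lambda_+t}-e^{\lambda_-t})\\ e^{\lambda_+t}-e^{\lambda_-t}&\lambda_+e^{\lambda_-t}-\lambda_-e^{\lambda_+t}\end{pmatrix}.$$ $|\hat G_f(t,k)|$ denotes the matrix of absolute values of the entries, and inequalities between matrices are entrywise. *)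

theory Defs
  imports "HOL-Analysis.Analysis"
begin

(* The library's (^) and exp are not usable for matrices here: the product that the type
   'a^'n inherits is the componentwise one.  Hence powers are taken with respect to (**). *)

definition mat_power :: "complex^'n^'n \<Rightarrow> nat \<Rightarrow> complex^'n^'n" where
  "mat_power M n = (((**) M) ^^ n) (mat 1)"

definition mat_exp :: "complex^'n^'n \<Rightarrow> complex^'n^'n" where
  "mat_exp M = (\<Sum>n. (1 / fact n) *\<^sub>R mat_power M n)"

definition mat_abs :: "complex^'n^'m \<Rightarrow> real^'n^'m" where
  "mat_abs M = (\<chi> i j. cmod (M $ i $ j))"

(* vector lists the rows of a matrix, so vector [vector [a, b], vector [c, d]] has first row (a, b). *)

definition A1_hat :: "real \<Rightarrow> real \<Rightarrow> complex^2^2" where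
  "A1_hat \<gamma> k = vector [vector [1, complex_of_real (1 + \<gamma> * k\<^sup>2)], vector [-1, 0]]"

definition Gf_hat :: "real \<Rightarrow> real \<Rightarrow> real \<Rightarrow> complex^2^2" where
  "Gf_hat \<gamma> t k = mat_exp ((- t) *\<^sub>R A1_hat \<gamma> k)"

definition lambda_plus :: "real \<Rightarrow> real \<Rightarrow> complex" where
  "lambda_plus \<gamma> k = (-1 + \<i> * complex_of_real (sqrt (3 + 4 * \<gamma> * k\<^sup>2))) / 2"

definition lambda_minus :: "real \<Rightarrow> real \<Rightarrow> complex" where
  "lambda_minus \<gamma> k = (-1 - \<i> * complex_of_real (sqrt (3 + 4 * \<gamma> * k\<^sup>2))) / 2"

lemma lambda_quadratic:
  assumes "\<gamma> > 0"
  shows "(lambda_plus \<gamma> k)\<^sup>2 = - lambda_plus \<gamma> k - complex_of_real (1 + \<gamma> * k\<^sup>2)"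
    and "(lambda_minus \<gamma> k)\<^sup>2 = - lambda_minus \<gamma> k - complex_of_real (1 + \<gamma> * k\<^sup>2)"
    and "lambda_plus \<gamma> k \<noteq> lambda_minus \<gamma> k"
    and "lambda_plus \<gamma> k + lambda_minus \<gamma> k = -1"
proof -
  define s where "s = sqrt (3 + 4 * \<gamma> * k\<^sup>2)"
  have "3 + 4 * \<gamma> * k\<^sup>2 > 0" using assms by (simp add: add_pos_nonneg)
  then have s: "s > 0" "s\<^sup>2 = 3 + 4 * \<gamma> * k\<^sup>2" by (auto simp: s_def)
  have gk: "1 + \<gamma> * k\<^sup>2 = (1 + s\<^sup>2) / 4" using s by simp
  show "(lambda_plus \<gamma> k)\<^sup>2 = - lambda_plus \<gamma> k - complex_of_real (1 + \<gamma> * k\<^sup>2)"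
       "(lambda_minus \<gamma> k)\<^sup>2 = - lambda_minus \<gamma> k - complex_of_real (1 + \<gamma> * k\<^sup>2)"
    unfolding gk lambda_plus_def lambda_minus_def s_def[symmetric]
    by (auto simp: complex_eq_iff power2_eq_square field_simps)
  show "lambda_plus \<gamma> k \<noteq> lambda_minus \<gamma> k" "lambda_plus \<gamma> k + lambda_minus \<gamma> k = -1"
    using s(1) unfolding lambda_plus_def lambda_minus_def s_def[symmetric]
    by (auto simp: complex_eq_iff)
qed

lemma mat_sums_componentwise:
  fixes f :: "nat \<Rightarrow> complex^2^2"
  assumes "\<And>i j. (\<lambda>n. f n $ i $ j) sums (S $ i $ j)"
  shows "f sums S"
  unfolding sums_def
  by (intro vec_tendstoI) (use assms in \<open>simp add: sums_def\<close>)

lemma Gf_hat_explicit: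
  fixes \<gamma> t k :: real
  assumes "\<gamma> > 0"
  defines "l \<equiv> lambda_plus \<gamma> k" and "m \<equiv> lambda_minus \<gamma> k"
  defines "E \<equiv> (\<lambda>z :: complex. exp (z * complex_of_real t))"
  defines "G \<equiv> (vector
      [vector [(l * E l - m * E m) / (l - m),
               - complex_of_real (1 + \<gamma> * k\<^sup>2) * (E l - E m) / (l - m)],
       vector [(E l - E m) / (l - m), (l * E m - m * E l) / (l - m)]] :: complex^2^2)"
  shows "(\<lambda>n. (1 / fact n) *\<^sub>R mat_power ((- t) *\<^sub>R A1_hat \<gamma> k) n) sums G"
    and "Gf_hat \<gamma> t k = G"
proof -
  define a where "a = complex_of_real (1 + \<gamma> * k\<^sup>2)"
  define M where "M = (- t) *\<^sub>R A1_hat \<gamma> k"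
  note quad = lambda_quadratic[OF assms(1), of k, folded l_def m_def a_def]
  have ll: "l * l = - l - a" and mm: "m * m = - m - a" and ne: "l - m \<noteq> 0"
    using quad by (auto simp: power2_eq_square)
  have lma: "l * m = a"
  proof -
    have "l * m = l * (l + m) - l * l" by (simp add: algebra_simps)
    also have "\<dots> = a" unfolding quad(4) ll by simp
    finally show ?thesis .
  qed
  have pow: "mat_power M n = vector
      [vector [of_real t ^ n * (l * l ^ n - m * m ^ n) / (l - m),
               - a * (of_real t ^ n * (l ^ n - m ^ n)) / (l - m)],
       vector [of_real t ^ n * (l ^ n - m ^ n) / (l - m),
               of_real t ^ n * (l * m ^ n - m * l ^ n) / (l - m)]]" for n
  proof (induction n)
    case 0
    show ?case using ne
      by (simp add: mat_power_def vec_eq_iff forall_2 mat_def)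
  next
    case (Suc n)
    have step: "mat_power M (Suc n) = M ** mat_power M n" by (simp add: mat_power_def)
    have M: "M = vector [vector [- of_real t, - of_real t * a], vector [of_real t, 0]]"
      unfolding M_def A1_hat_def a_def
      by (simp add: vec_eq_iff forall_2) (simp add: scaleR_conv_of_real)
    have red: "l * (l * x) = - (l * x) - a * x" "m * (m * x) = - (m * x) - a * x"
      "l * (m * x) = a * x" "m * (l * x) = a * x" for x
      using ll mm lma by (metis mult.assoc mult.commute left_diff_distrib mult_minus_left)+
    have red': "a * (l * x) = - (a * x) - a * (m * x)" for x
    proof -
      have "a * (l * x) = a * ((l + m) * x) - a * (m * x)" by (simp add: algebra_simps)
      then show ?thesis unfolding quad(4) by simp
    qed
    show ?case
      unfolding step Suc unfolding M
      by (simp add: vec_eq_iff forall_2 matrix_matrix_mult_def sum_2)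
         (use ne in \<open>simp add: divide_simps\<close>, simp add: algebra_simps red red')
  qed
  have e: "(\<lambda>n. (of_real t * z) ^ n / fact n) sums E z" for z :: complex
    using exp_converges[of "of_real t * z"]
    by (simp add: E_def scaleR_conv_of_real field_simps)
  show "(\<lambda>n. (1 / fact n) *\<^sub>R mat_power M n) sums G"
  proof (rule mat_sums_componentwise)
    fix i j :: 2
    have c: "(\<lambda>n. (p * ((of_real t * l) ^ n / fact n) + q * ((of_real t * m) ^ n / fact n)) / (l - m))
       sums ((p * E l + q * E m) / (l - m))" for p q
      by (intro sums_divide sums_add sums_mult e)
    define d where "d = l - m"
    have "\<forall>i j. (\<lambda>n. ((1 / fact n) *\<^sub>R mat_power M n) $ i $ j) sums (G $ i $ j)"
      using c[of l "- m"] c[of "- a" a] c[of 1 "-1"] c[of "- m" l]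
      unfolding pow G_def a_def[symmetric] d_def[symmetric]
      by (simp add: forall_2 scaleR_conv_of_real[where 'a=complex] power_mult_distrib
          algebra_simps add_divide_distrib diff_divide_distrib)
    then show "(\<lambda>n. ((1 / fact n) *\<^sub>R mat_power M n) $ i $ j) sums (G $ i $ j)" by blast
  qed
  then show "Gf_hat \<gamma> t k = G"
    unfolding Gf_hat_def mat_exp_def M_def by (simp add: sums_iff)
qed

end

theory Submission
  imports Defs
begin

text \<open>
  Both eigenvalues \<open>\<lambda>\<^sub>\<plusminus>\<close> of \<open>- A\<^sub>1\<close> have real part \<open>- 1/2\<close>, so every exponential
  in the explicit formula for the Green's function has modulus exactly \<open>exp (- t / 2)\<close>,
  and only the algebraic prefactors need to be estimated.  They are controlled by the eigenvalue gap
  \<open>s = \<bar>\<lambda>\<^sub>+ - \<lambda>\<^sub>-\<bar> = sqrt (3 + 4\<gamma>k\<^sup>2)\<close>: since \<open>\<bar>\<lambda>\<^sub>\<plusminus>\<bar>\<^sup>2 = 1 + \<gamma>k\<^sup>2 = (1 + s\<^sup>2) / 4 \<le> s\<^sup>2\<close>,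
  the triangle inequality gives one bound valid for all \<open>k\<close>, with the matrix of prefactors
  \<open>2 (1, s; 1/s, 1)\<close> (lemma \<open>Gf_hat_bound_gap\<close>).

  The threshold for \<open>\<bar>k\<bar>\<close> is the point where \<open>4\<gamma>k\<^sup>2 = 3\<close>, that is, where the two summands in
  \<open>s\<^sup>2\<close> balance.  Below it \<open>s\<close> stays between two constants; above it \<open>s\<close> is comparable to
  \<open>sqrt \<gamma> \<bar>k\<bar>\<close> (lemmas \<open>gap_low_frequency\<close> and \<open>gap_high_frequency\<close>).  The constant \<open>C\<close>
  depends on \<open>\<gamma>\<close> through the latter comparison.
\<close>

definition eigenvalue_gap :: "real \<Rightarrow> real \<Rightarrow> real" where
  "eigenvalue_gap \<gamma> k = sqrt (3 + 4 * \<gamma> * k\<^sup>2)"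

lemma eigenvalue_gap_square:
  assumes "\<gamma> > 0"
  shows "(eigenvalue_gap \<gamma> k)\<^sup>2 = 3 + 4 * \<gamma> * k\<^sup>2"
  using assms by (simp add: eigenvalue_gap_def)

lemma eigenvalue_gap_gt_1:
  assumes "\<gamma> > 0"
  shows "eigenvalue_gap \<gamma> k > 1"
proof -
  have "1 < 3 + 4 * \<gamma> * k\<^sup>2" using assms by (simp add: add_pos_nonneg add_strict_increasing2)
  then show ?thesis by (simp add: eigenvalue_gap_def)
qed

lemma norm_lambda_diff:
  assumes "\<gamma> > 0"
  shows "cmod (lambda_plus \<gamma> k - lambda_minus \<gamma> k) = eigenvalue_gap \<gamma> k"
proof -
  have "lambda_plus \<gamma> k - lambda_minus \<gamma> k = \<i> * complex_of_real (eigenvalue_gap \<gamma> k)"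
    by (simp add: lambda_plus_def lambda_minus_def eigenvalue_gap_def field_simps)
  then show ?thesis using eigenvalue_gap_gt_1[OF assms, of k] by (simp add: norm_mult)
qed

lemma norm_lambda_le_gap:
  assumes "\<gamma> > 0"
  shows "cmod (lambda_plus \<gamma> k) \<le> eigenvalue_gap \<gamma> k"
    and "cmod (lambda_minus \<gamma> k) \<le> eigenvalue_gap \<gamma> k"
proof -
  define s where "s = eigenvalue_gap \<gamma> k"
  have s: "s > 1" using eigenvalue_gap_gt_1[OF assms] by (simp add: s_def)
  then have "1 \<le> s\<^sup>2" by simp
  then have "(1 / 4 + s\<^sup>2 / 4) \<le> s\<^sup>2" by simp
  then have "sqrt (1 / 4 + s\<^sup>2 / 4) \<le> s" using s by (intro real_le_lsqrt) auto
  then show "cmod (lambda_plus \<gamma> k) \<le> eigenvalue_gap \<gamma> k"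
    and "cmod (lambda_minus \<gamma> k) \<le> eigenvalue_gap \<gamma> k"
    unfolding lambda_plus_def lambda_minus_def eigenvalue_gap_def[symmetric] s_def[symmetric]
    by (simp_all add: cmod_def power_divide)
qed

lemma norm_exp_lambda:
  "cmod (exp (lambda_plus \<gamma> k * complex_of_real t)) = exp (- t / 2)"
  "cmod (exp (lambda_minus \<gamma> k * complex_of_real t)) = exp (- t / 2)"
  by (simp_all add: norm_exp_eq_Re lambda_plus_def lambda_minus_def)

lemma norm_two_term_quotient_le:
  fixes p q x y d :: complex
  assumes "cmod p \<le> r" "cmod q \<le> r" "cmod x = e" "cmod y = e"
  shows "cmod ((p * x - q * y) / d) \<le> 2 * e * (r / cmod d)"
proof -
  have "e \<ge> 0" using assms(3) by auto
  have "cmod (p * x - q * y) \<le> cmod p * cmod x + cmod q * cmod y"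
    by (metis norm_mult norm_triangle_ineq4)
  also have "\<dots> \<le> r * e + r * e"
    unfolding assms(3,4) using assms(1,2) \<open>e \<ge> 0\<close> by (intro add_mono mult_right_mono)
  also have "\<dots> = 2 * e * r" by simp
  finally have "cmod (p * x - q * y) / cmod d \<le> 2 * e * r / cmod d"
    by (rule divide_right_mono) simp
  then show ?thesis by (simp add: norm_divide)
qed

text \<open>Each entry is a combination of two exponentials of modulus \<open>exp (- t / 2)\<close>, with
  coefficients of modulus at most \<open>s\<close> on the diagonal, \<open>1 + \<gamma>k\<^sup>2 \<le> s\<^sup>2\<close> in the upper right
  corner, and 1 in the lower left corner, divided by a number of modulus \<open>s\<close>.\<close>

lemma Gf_hat_bound_gap:
  assumes "\<gamma> > 0"
  shows "mat_abs (Gf_hat \<gamma> t k) \<le> (2 * exp (- t / 2)) *\<^sub>R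
    vector [vector [1, eigenvalue_gap \<gamma> k], vector [inverse (eigenvalue_gap \<gamma> k), 1]]"
proof -
  define l where "l = lambda_plus \<gamma> k"
  define m where "m = lambda_minus \<gamma> k"
  define s where "s = eigenvalue_gap \<gamma> k"
  define x where "x = exp (l * complex_of_real t)"
  define y where "y = exp (m * complex_of_real t)"
  define a where "a = complex_of_real (1 + \<gamma> * k\<^sup>2)"
  have s: "s > 1" using eigenvalue_gap_gt_1[OF assms] by (simp add: s_def)
  have d: "cmod (l - m) = s" by (simp add: norm_lambda_diff[OF assms] l_def m_def s_def)
  have lm: "cmod l \<le> s" "cmod m \<le> s"
    using norm_lambda_le_gap[OF assms] by (simp_all add: l_def m_def s_def)
  have xy: "cmod x = exp (- t / 2)" "cmod y = exp (- t / 2)"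
    by (simp_all only: x_def y_def l_def m_def norm_exp_lambda)
  have "s\<^sup>2 = 3 + 4 * \<gamma> * k\<^sup>2" by (simp add: s_def eigenvalue_gap_square[OF assms])
  moreover have "\<gamma> * k\<^sup>2 \<ge> 0" using assms by simp
  ultimately have a: "cmod (- a) \<le> s\<^sup>2" by (simp add: a_def norm_of_real del: of_real_add)
  have e11: "cmod ((l * x - m * y) / (l - m)) \<le> 2 * exp (- t / 2)"
    using norm_two_term_quotient_le[OF lm xy, of "l - m"] s d by simp
  have e12: "cmod (- a * (x - y) / (l - m)) \<le> 2 * exp (- t / 2) * s"
  proof -
    have "s\<^sup>2 / cmod (l - m) = s" using s d by (simp add: power2_eq_square)
    then show ?thesis
      using norm_two_term_quotient_le[OF a a xy, of "l - m"] by (simp only: right_diff_distrib)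
  qed
  have e21: "cmod ((x - y) / (l - m)) \<le> 2 * exp (- t / 2) * inverse s"
    using norm_two_term_quotient_le[of 1 1 1 x _ y "l - m", OF _ _ xy] d
    by (simp add: inverse_eq_divide)
  have e22: "cmod ((l * y - m * x) / (l - m)) \<le> 2 * exp (- t / 2)"
    using norm_two_term_quotient_le[OF lm xy(2,1), of "l - m"] s d by simp
  show ?thesis
    unfolding Gf_hat_explicit(2)[OF assms] l_def[symmetric] m_def[symmetric]
      x_def[symmetric] y_def[symmetric] a_def[symmetric] s_def[symmetric]
    using e11 e12 e21 e22
    by (simp add: mat_abs_def less_eq_vec_def forall_2)
qed

lemma frequency_threshold_iff:
  assumes "\<gamma> > 0"
  shows "\<bar>k\<bar> \<le> sqrt (3 * \<gamma>) / (2 * \<gamma>) \<longleftrightarrow> 4 * \<gamma> * k\<^sup>2 \<le> 3"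
proof -
  have "\<bar>k\<bar> \<le> sqrt (3 * \<gamma>) / (2 * \<gamma>) \<longleftrightarrow> 2 * \<gamma> * \<bar>k\<bar> \<le> sqrt (3 * \<gamma>)"
    using assms by (simp add: field_simps)
  also have "2 * \<gamma> * \<bar>k\<bar> = sqrt ((2 * \<gamma> * k)\<^sup>2)" using assms by (simp add: abs_mult)
  also have "\<dots> \<le> sqrt (3 * \<gamma>) \<longleftrightarrow> \<gamma> * (4 * \<gamma> * k\<^sup>2) \<le> \<gamma> * 3"
    by (simp add: power2_eq_square algebra_simps)
  also have "\<dots> \<longleftrightarrow> 4 * \<gamma> * k\<^sup>2 \<le> 3" using assms by (simp only: mult_le_cancel_left_pos)
  finally show ?thesis .
qed

lemma gap_low_frequency:
  assumes "4 * \<gamma> * k\<^sup>2 \<le> 3"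
  shows "eigenvalue_gap \<gamma> k \<le> 3"
  unfolding eigenvalue_gap_def using assms by (intro real_le_lsqrt) auto

lemma gap_high_frequency:
  assumes "\<gamma> > 0" "4 * \<gamma> * k\<^sup>2 > 3"
  shows "eigenvalue_gap \<gamma> k \<le> 3 * (sqrt \<gamma> * \<bar>k\<bar>)"
    and "2 * (sqrt \<gamma> * \<bar>k\<bar>) \<le> eigenvalue_gap \<gamma> k"
proof -
  have sq: "(c * (sqrt \<gamma> * \<bar>k\<bar>))\<^sup>2 = c\<^sup>2 * (\<gamma> * k\<^sup>2)" for c
    using assms(1) by (simp add: power_mult_distrib)
  show "eigenvalue_gap \<gamma> k \<le> 3 * (sqrt \<gamma> * \<bar>k\<bar>)"
    unfolding eigenvalue_gap_def using assms
    by (intro real_le_lsqrt) (simp_all add: sq[of 3, simplified])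
  show "2 * (sqrt \<gamma> * \<bar>k\<bar>) \<le> eigenvalue_gap \<gamma> k"
    unfolding eigenvalue_gap_def by (intro real_le_rsqrt) (simp add: sq[of 2, simplified])
qed

lemma Gf_hat_bound_mono:
  assumes "\<gamma> > 0" "2 \<le> C"
    and "2 * eigenvalue_gap \<gamma> k \<le> C * b"
    and "2 * inverse (eigenvalue_gap \<gamma> k) \<le> C * c"
  shows "mat_abs (Gf_hat \<gamma> t k) \<le> (C * exp (- t / 2)) *\<^sub>R vector [vector [1, b], vector [c, 1]]"
proof -
  define e where "e = exp (- t / 2)"
  have e: "e > 0" by (simp add: e_def)
  have "(2 * e) *\<^sub>R vector [vector [1, eigenvalue_gap \<gamma> k],
          vector [inverse (eigenvalue_gap \<gamma> k), 1]]
      \<le> (C * e) *\<^sub>R (vector [vector [1, b], vector [c, 1]] :: real^2^2)"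
    using assms(2) mult_right_mono[OF assms(3), of e] mult_right_mono[OF assms(4), of e] e
    by (simp add: less_eq_vec_def forall_2 mult_ac)
  with Gf_hat_bound_gap[OF assms(1), of t k] show ?thesis
    unfolding e_def by (rule order_trans)
qed

theorem proposition2p8:
  fixes \<gamma> :: real
  assumes "\<gamma> > 0"
  shows "\<exists>C>0. \<forall>t k :: real. t \<ge> 0 \<longrightarrow>
    (\<bar>k\<bar> \<le> sqrt (3 * \<gamma>) / (2 * \<gamma>) \<longrightarrow>
       mat_abs (Gf_hat \<gamma> t k) \<le>
         (C * exp (- t / 2)) *\<^sub>R vector [vector [1, 1], vector [1, 1]]) \<and>
    (\<bar>k\<bar> > sqrt (3 * \<gamma>) / (2 * \<gamma>) \<longrightarrow>
       mat_abs (Gf_hat \<gamma> t k) \<le>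
         (C * exp (- t / 2)) *\<^sub>R vector [vector [1, \<bar>k\<bar>], vector [inverse \<bar>k\<bar>, 1]])"
proof -
  define g where "g = sqrt \<gamma>"
  have g: "g > 0" using assms by (simp add: g_def)
  \<comment> \<open>The summands serve, in this order, the low frequencies and the diagonal, the upper right
    corner at high frequencies, and the lower left corner at high frequencies.\<close>
  define C where "C = 6 + 6 * g + inverse g"
  have C: "6 \<le> C" "6 * g \<le> C" "inverse g \<le> C" using g by (auto simp: C_def)
  have low: "mat_abs (Gf_hat \<gamma> t k) \<le>
      (C * exp (- t / 2)) *\<^sub>R vector [vector [1, 1], vector [1, 1]]"
    if "\<bar>k\<bar> \<le> sqrt (3 * \<gamma>) / (2 * \<gamma>)" for t k
  proof (rule Gf_hat_bound_mono[OF assms])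
    define s where "s = eigenvalue_gap \<gamma> k"
    have s: "s > 1" "s \<le> 3"
      using eigenvalue_gap_gt_1[OF assms] gap_low_frequency that
      by (simp_all add: s_def frequency_threshold_iff[OF assms])
    have "inverse s \<le> 1" using s by (simp add: inverse_le_1_iff)
    then show "2 * inverse (eigenvalue_gap \<gamma> k) \<le> C * 1" using C by (simp add: s_def)
    show "2 \<le> C" "2 * eigenvalue_gap \<gamma> k \<le> C * 1" using C s by (simp_all add: s_def)
  qed
  have high: "mat_abs (Gf_hat \<gamma> t k) \<le>
      (C * exp (- t / 2)) *\<^sub>R vector [vector [1, \<bar>k\<bar>], vector [inverse \<bar>k\<bar>, 1]]"
    if "\<bar>k\<bar> > sqrt (3 * \<gamma>) / (2 * \<gamma>)" for t k
  proof (rule Gf_hat_bound_mono[OF assms])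
    define s where "s = eigenvalue_gap \<gamma> k"
    have k2: "4 * \<gamma> * k\<^sup>2 > 3"
      using that frequency_threshold_iff[OF assms, of k] by linarith
    then have k: "\<bar>k\<bar> > 0" by auto
    have s: "s \<le> 3 * (g * \<bar>k\<bar>)" "2 * (g * \<bar>k\<bar>) \<le> s"
      using gap_high_frequency[OF assms k2] by (simp_all add: s_def g_def)
    show "2 \<le> C" using C by simp
    have "2 * s \<le> (6 * g) * \<bar>k\<bar>" using s by simp
    also have "\<dots> \<le> C * \<bar>k\<bar>" using C k by (intro mult_right_mono) auto
    finally show "2 * eigenvalue_gap \<gamma> k \<le> C * \<bar>k\<bar>" by (simp add: s_def)
    have "2 * inverse s \<le> 2 * inverse (2 * (g * \<bar>k\<bar>))"
      using s g k by (intro mult_left_mono le_imp_inverse_le) auto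
    also have "\<dots> = inverse g * inverse \<bar>k\<bar>" by simp
    also have "\<dots> \<le> C * inverse \<bar>k\<bar>" using C k by (intro mult_right_mono) auto
    finally show "2 * inverse (eigenvalue_gap \<gamma> k) \<le> C * inverse \<bar>k\<bar>" by (simp add: s_def)
  qed
  have "C > 0" using C by simp
  then show ?thesis using low high by blast
qed

end
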